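(* Let $t\ge 1$ and let $k$ be a positive integer with $k\equiv t \pmod{2^{\lfloor \log_2 t\rfloor+1}}$. Then for every $n>k$, every binary $t$-$(n,k)$-design is a binary $s$-$(n,k)$-design for all $0\le s\le t$. Moreover, for $n\ge k+t+1$, every binary $t$-$(n,k)$-design has at least $2^{t+1}$ blocks, and $d_{t,n,k}=2^{t+1}$.
   Context: Let $N$ be an $n$-element set of points. For nonnegative integers $t,k$, a binary $t$-$(n,k)$-design is a nonempty set $D$ of $k$-element subsets of $N$ (blocks; no repeated blocks) such that every $t$-element subset of $N$ is contained in an even number of blocks of $D$ (for $t=0$: $|D|$ is even). $d_{t,n,k}$ denotes the minimum number of blocks of a binary $t$-$(n,k)$-design, equivalently the minimum distance of the binary linear code whose parity-check matrix is the inclusion matrix of $t$-subsets versus $k$-subsets of an $n$-set.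
   Formalization: The equality d_{t,n,k} = 2^{t+1} is stated only for k ≠ t: when k = t each block is a t-subset lying in exactly one block, so no binary t-(n,t)-design exists and the minimum is undefined; the other claims are kept for k = t. *)

theory Defs
  imports Complex_Main "HOL-Library.Extended_Nat" "HOL-Library.Ramsey" "HOL-Number_Theory.Cong"
begin

text \<open>\<^term>\<open>nsets N k\<close> is the set of \<open>k\<close>-element subsets of \<open>N\<close>. For \<open>t = 0\<close> the parity condition
  concerns the single set \<^term>\<open>{}\<close> and says that the number of blocks is even.\<close>

definition binary_design :: "nat \<Rightarrow> 'a set \<Rightarrow> nat \<Rightarrow> 'a set set \<Rightarrow> bool" where
  "binary_design t N k D \<longleftrightarrow>
     D \<noteq> {} \<and> D \<subseteq> nsets N k \<and> (\<forall>T\<in>nsets N t. even (card {B \<in> D. T \<subseteq> B}))"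

text \<open>The minimum number of blocks depends on the point set only through its size, so the points
  are taken to be \<^term>\<open>{..<n}\<close>. Values in \<^typ>\<open>enat\<close> make the minimum \<open>\<infinity>\<close> when there is no design,
  and a finite value is always attained.\<close>

definition min_blocks :: "nat \<Rightarrow> nat \<Rightarrow> nat \<Rightarrow> enat" where
  "min_blocks t n k = (INF D \<in> {D. binary_design t {..<n} k D}. enat (card D))"

end

theory Submission
  imports Defs
begin

text \<open>
  Counting the pairs \<open>T \<subseteq> B\<close> with \<open>S \<subseteq> T\<close> shows that a binary \<open>t\<close>-design is a binary
  \<open>s\<close>-design as soon as \<open>k - s choose t - s\<close> is odd, and the congruence makes all these
  coefficients odd. A nonempty family that meets the parity condition for all sets of at most \<open>t\<close>
  points is a nonzero word of a Reed--Muller code: splitting it at a point that separates two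
  blocks gives two such families for \<open>t - 1\<close>, whence at least \<open>2 ^ (t + 1)\<close> blocks. Equality
  holds for the blocks that consist of a fixed set and one point from each of \<open>t + 1\<close> disjoint
  pairs.
\<close>

text \<open>For subsets of a finite point set this says that the characteristic word of
  \<open>D\<close> is orthogonal to all monomials of degree below \<open>r\<close>. The strict bound
  makes \<open>r = 0\<close> vacuous, which starts both inductions on \<open>r\<close>; leaving out
  a point set lets \<open>D\<close> be split or extended freely.\<close>

definition even_below :: "nat \<Rightarrow> 'a set set \<Rightarrow> bool" where
  "even_below r D \<longleftrightarrow> (\<forall>S. finite S \<and> card S < r \<longrightarrow> even (card {B \<in> D. S \<subseteq> B}))"

text \<open>With \<open>M = m * 2 ^ e\<close>, absorption gives
  \<open>j * (M choose j) = M * ((M - 1) choose (j - 1))\<close>. If \<open>M choose j\<close> were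
  odd, \<open>2 ^ e\<close> would have to divide \<open>j\<close>, which is too small.\<close>

lemma even_power_two_multiple_choose:
  fixes m e j :: nat
  assumes "0 < j" "j < 2 ^ e"
  shows "even ((m * 2 ^ e) choose j)"
proof (rule ccontr)
  assume "odd ((m * 2 ^ e) choose j)"
  then have "coprime (2 ^ e) ((m * 2 ^ e) choose j)"
    by (simp add: coprime_power_left_iff)
  moreover have "(2::nat) ^ e dvd j * ((m * 2 ^ e) choose j)"
    using assms(1) times_binomial_minus1_eq[of j "m * 2 ^ e"] by simp
  ultimately have "2 ^ e dvd j"
    by (simp add: coprime_dvd_mult_left_iff)
  with assms show False
    using dvd_imp_le by fastforce
qed

text \<open>A case of Lucas's theorem: in the Vandermonde sum every term except \<open>j = 0\<close>
  is even, and that term is 1.\<close>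

lemma odd_choose_add_power_two_multiple:
  fixes a m e :: nat
  assumes "a < 2 ^ e"
  shows "odd ((a + m * 2 ^ e) choose a)"
proof -
  let ?f = "\<lambda>j. ((m * 2 ^ e) choose j) * (a choose (a - j))"
  have "(a + m * 2 ^ e) choose a = (\<Sum>j\<le>a. ?f j)"
    by (simp add: vandermonde add.commute)
  also have "\<dots> = ?f 0 + (\<Sum>j\<in>{..a} - {0}. ?f j)"
    by (rule sum.remove) auto
  finally have "(a + m * 2 ^ e) choose a = 1 + (\<Sum>j\<in>{..a} - {0}. ?f j)"
    by simp
  moreover have "even (\<Sum>j\<in>{..a} - {0}. ?f j)"
    by (intro dvd_sum dvd_mult2 even_power_two_multiple_choose) (use assms in auto)
  ultimately show ?thesis by simp
qed

lemma card_between: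
  assumes "finite B" "S \<subseteq> B" "card S \<le> t"
  shows "card {T. S \<subseteq> T \<and> T \<subseteq> B \<and> card T = t} = (card B - card S) choose (t - card S)"
proof -
  have fS: "finite S" using assms finite_subset by blast
  have "bij_betw ((\<union>) S) {U. U \<subseteq> B - S \<and> card U = t - card S}
          {T. S \<subseteq> T \<and> T \<subseteq> B \<and> card T = t}"
  proof (rule bij_betw_byWitness[where f' = "\<lambda>T. T - S"])
    show "(\<union>) S ` {U. U \<subseteq> B - S \<and> card U = t - card S} \<subseteq> {T. S \<subseteq> T \<and> T \<subseteq> B \<and> card T = t}"
    proof (clarsimp, intro conjI)
      fix U assume U: "U \<subseteq> B - S" "card U = t - card S"
      then have "finite U" using assms(1) finite_subset by blast
      then have "card (S \<union> U) = card S + card U"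
        using U fS by (intro card_Un_disjoint) auto
      then show "card (S \<union> U) = t" using U assms(3) by simp
      show "S \<subseteq> B" "U \<subseteq> B" using U assms(2) by auto
    qed
    show "(\<lambda>T. T - S) ` {T. S \<subseteq> T \<and> T \<subseteq> B \<and> card T = t} \<subseteq> {U. U \<subseteq> B - S \<and> card U = t - card S}"
      using fS by (auto simp: card_Diff_subset)
  qed auto
  then have "card {T. S \<subseteq> T \<and> T \<subseteq> B \<and> card T = t} = card {U. U \<subseteq> B - S \<and> card U = t - card S}"
    by (simp add: bij_betw_same_card)
  also have "\<dots> = card (B - S) choose (t - card S)"
    using assms(1) by (simp add: n_subsets)
  also have "card (B - S) = card B - card S"
    using fS assms(2) by (rule card_Diff_subset)
  finally show ?thesis .
qed

text \<open>Summing over \<open>T\<close> gives an even total, since each \<open>T\<close> lies in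
  evenly many blocks. Summing over blocks counts each block through \<open>S\<close> exactly
  \<open>(k - s) choose (t - s)\<close> times, and this odd factor cancels modulo 2.\<close>

lemma binary_design_lower:
  assumes N: "finite N" and D: "binary_design t N k D"
    and "s \<le> t" and odd: "odd ((k - s) choose (t - s))"
  shows "binary_design s N k D"
proof -
  have DN: "D \<subseteq> nsets N k" "D \<noteq> {}" using D by (auto simp: binary_design_def)
  have fD: "finite D" using DN(1) N by (meson finite_imp_finite_nsets finite_subset)
  have "even (card {B \<in> D. S \<subseteq> B})" if S: "S \<in> nsets N s" for S
  proof -
    let ?X = "{T \<in> nsets N t. S \<subseteq> T}"
    have fX: "finite ?X" using N by (simp add: finite_imp_finite_nsets)
    have inner: "card {T \<in> ?X. T \<subseteq> B} = (if S \<subseteq> B then (k - s) choose (t - s) else 0)"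
      if "B \<in> D" for B
    proof (cases "S \<subseteq> B")
      case True
      have B: "B \<subseteq> N" "finite B" "card B = k" using that DN(1) by (auto simp: nsets_def)
      have "{T \<in> ?X. T \<subseteq> B} = {T. S \<subseteq> T \<and> T \<subseteq> B \<and> card T = t}"
        using B by (auto simp: nsets_def intro: finite_subset)
      then show ?thesis
        using card_between[of B S t] B True S \<open>s \<le> t\<close> by (simp add: nsets_def)
    next
      case False
      then have "{T \<in> ?X. T \<subseteq> B} = {}" by blast
      then show ?thesis using False by (simp only: card.empty if_False)
    qed
    have "(\<Sum>T\<in>?X. card {B \<in> D. T \<subseteq> B}) = (\<Sum>B\<in>D. card {T \<in> ?X. T \<subseteq> B})"
      using fX fD by (rule sum_multicount_gen[OF _ _ ballI[OF refl]])
    also have "\<dots> = (\<Sum>B\<in>D. if S \<subseteq> B then (k - s) choose (t - s) else 0)"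
      using inner by (intro sum.cong refl) blast
    also have "\<dots> = card {B \<in> D. S \<subseteq> B} * ((k - s) choose (t - s))"
      using fD by (simp add: sum.If_cases Int_def)
    finally have eq: "(\<Sum>T\<in>?X. card {B \<in> D. T \<subseteq> B})
        = card {B \<in> D. S \<subseteq> B} * ((k - s) choose (t - s))" .
    have "even (\<Sum>T\<in>?X. card {B \<in> D. T \<subseteq> B})"
      using D by (intro dvd_sum) (auto simp: binary_design_def)
    with eq odd show ?thesis by simp
  qed
  then show ?thesis using DN by (auto simp: binary_design_def)
qed

text \<open>Sets that are not contained in \<open>N\<close> lie in no block, so letting
  \<open>S\<close> range over all finite sets adds no condition.\<close>

lemma even_below_iff_binary_design:
  assumes "D \<noteq> {}" "D \<subseteq> nsets N k"
  shows "even_below r D \<longleftrightarrow> (\<forall>s<r. binary_design s N k D)"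
proof
  assume "even_below r D"
  then show "\<forall>s<r. binary_design s N k D"
    using assms by (auto simp: even_below_def binary_design_def nsets_def)
next
  assume *: "\<forall>s<r. binary_design s N k D"
  have "even (card {B \<in> D. S \<subseteq> B})" if S: "finite S" "card S < r" for S
  proof (cases "S \<subseteq> N")
    case True
    then have "S \<in> nsets N (card S)" using S by (simp add: nsets_def)
    then show ?thesis using * S by (auto simp: binary_design_def)
  next
    case False
    then have "{B \<in> D. S \<subseteq> B} = {}" using assms(2) by (auto simp: nsets_def)
    then show ?thesis by (simp only: card.empty even_zero)
  qed
  then show "even_below r D" by (auto simp: even_below_def)
qed

lemma even_below_card_ge:
  assumes "finite D" "D \<noteq> {}" "even_below r D"
  shows "2 ^ r \<le> card D"
  using assms
proof (induction r arbitrary: D)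
  case 0
  then show ?case by (simp add: Suc_le_eq card_gt_0_iff)
next
  case (Suc r)
  have ev: "even (card {B \<in> D. S \<subseteq> B})" if "finite S" "card S < Suc r" for S
    using Suc.prems(3) that by (auto simp: even_below_def)
  have "even (card D)" using ev[of "{}"] by simp
  \<comment> \<open>A positive even number is at least 2, so there are two distinct blocks, and some
    point lies in exactly one of them.\<close>
  with Suc.prems have "\<not> card D \<le> Suc 0"
    by (metis One_nat_def card_gt_0_iff le_Suc_eq le_zero_eq less_irrefl odd_one)
  then obtain A B where "A \<in> D" "B \<in> D" "A \<noteq> B"
    using Suc.prems(1) card_le_Suc0_iff_eq by blast
  then obtain x where x: "{B \<in> D. x \<in> B} \<noteq> {}" "{B \<in> D. x \<notin> B} \<noteq> {}"
    by blast
  let ?D1 = "{B \<in> D. x \<in> B}" and ?D0 = "{B \<in> D. x \<notin> B}"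
  have split: "card {B \<in> D. P B} = card {B \<in> ?D1. P B} + card {B \<in> ?D0. P B}" for P
  proof -
    have "{B \<in> D. P B} = {B \<in> ?D1. P B} \<union> {B \<in> ?D0. P B}" by auto
    then show ?thesis
      using Suc.prems(1) by (simp only:) (rule card_Un_disjoint; auto)
  qed
  \<comment> \<open>Asking for \<open>x\<close> as well costs at most one point, which is why the
    bound drops from \<open>Suc r\<close> to \<open>r\<close>. The half without \<open>x\<close>
    then follows by subtraction.\<close>
  have ev1: "even (card {B \<in> ?D1. S \<subseteq> B})" if "finite S" "card S < r" for S
  proof -
    have "card (insert x S) < Suc r" using that by (simp add: card_insert_if)
    then have "even (card {B \<in> D. insert x S \<subseteq> B})" using that by (intro ev) auto
    also have "{B \<in> D. insert x S \<subseteq> B} = {B \<in> ?D1. S \<subseteq> B}" by auto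
    finally show ?thesis .
  qed
  have ev0: "even (card {B \<in> ?D0. S \<subseteq> B})" if "finite S" "card S < r" for S
    using ev[of S] ev1[of S] split[of "\<lambda>B. S \<subseteq> B"] that by simp
  have "2 ^ r \<le> card ?D1" "2 ^ r \<le> card ?D0"
    using Suc.prems(1) x ev0 ev1 by (auto intro!: Suc.IH simp: even_below_def)
  then show ?case using split[of "\<lambda>_. True"] by simp
qed

text \<open>Unfolding the induction gives \<open>r\<close> disjoint pairs and \<open>k - r\<close>
  fixed points, hence \<open>k + r\<close> points in all; this explains both hypotheses.\<close>

lemma exists_even_below:
  fixes n k r :: nat
  assumes "r \<le> k" "k + r \<le> n"
  shows "\<exists>D. D \<subseteq> nsets {..<n} k \<and> even_below r D \<and> card D = 2 ^ r"
  using assms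
proof (induction r arbitrary: n k)
  case 0
  then have "{{..<k}} \<subseteq> nsets {..<n} k" by (auto simp: nsets_def)
  then show ?case by (intro exI[of _ "{{..<k}}"]) (simp add: even_below_def)
next
  case (Suc r)
  \<comment> \<open>The last two points form the new pair; the old blocks have one point fewer and
    avoid both.\<close>
  define p q j where "p = n - 2" and "q = n - 1" and "j = k - 1"
  have n: "n = Suc (Suc p)" "q = Suc p" and k: "k = Suc j"
    using Suc.prems by (auto simp: p_def q_def j_def)
  have "r \<le> j" "j + r \<le> p" using Suc.prems n k by auto
  from Suc.IH[OF this] obtain D where
    D: "D \<subseteq> nsets {..<p} j" "even_below r D" "card D = 2 ^ r" by blast
  have fD: "finite D" using D(3) by (metis card.infinite power_not_zero zero_neq_numeral)
  have pq: "p \<notin> B" "q \<notin> B" "finite B" "card B = j" "B \<subseteq> {..<p}" if "B \<in> D" for B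
    using subsetD[OF D(1) that] n by (auto simp: nsets_def)
  let ?E = "\<lambda>x. insert x ` D"
  have inj: "inj_on (insert x) D" if "x \<in> {p, q}" for x
    using that pq by (intro inj_onI) (auto dest: insert_ident[THEN iffD1, rotated 2])
  have disj: "?E p \<inter> ?E q = {}"
  proof -
    have "insert p A \<noteq> insert q B" if "A \<in> D" "B \<in> D" for A B
    proof -
      have "p \<notin> insert q B" using pq(1)[OF \<open>B \<in> D\<close>] n by simp
      then show ?thesis by blast
    qed
    then show ?thesis by blast
  qed
  have count: "card {B \<in> ?E x. S \<subseteq> B} = card {B \<in> D. S - {x} \<subseteq> B}" if "x \<in> {p, q}" for x S
  proof -
    have "{B \<in> ?E x. S \<subseteq> B} = insert x ` {B \<in> D. S - {x} \<subseteq> B}" by auto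
    moreover have "inj_on (insert x) {B \<in> D. S - {x} \<subseteq> B}"
      using inj[OF that] by (rule inj_on_subset) auto
    ultimately show ?thesis by (simp add: card_image)
  qed
  have "even_below (Suc r) (?E p \<union> ?E q)"
    unfolding even_below_def
  proof (intro allI impI)
    fix S :: "nat set" assume S: "finite S \<and> card S < Suc r"
    have "{B \<in> ?E p \<union> ?E q. S \<subseteq> B} = {B \<in> ?E p. S \<subseteq> B} \<union> {B \<in> ?E q. S \<subseteq> B}" by auto
    moreover have "{B \<in> ?E p. S \<subseteq> B} \<inter> {B \<in> ?E q. S \<subseteq> B} = {}" using disj by blast
    ultimately have "card {B \<in> ?E p \<union> ?E q. S \<subseteq> B} = card {B \<in> ?E p. S \<subseteq> B} + card {B \<in> ?E q. S \<subseteq> B}"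
      using fD by (simp only: card_Un_disjoint finite_Collect_conjI finite_imageI Collect_mem_eq simp_thms)
    then have c: "card {B \<in> ?E p \<union> ?E q. S \<subseteq> B}
        = card {B \<in> D. S - {p} \<subseteq> B} + card {B \<in> D. S - {q} \<subseteq> B}"
      by (simp add: count)
    have ev: "even (card {B \<in> D. S - {x} \<subseteq> B})" if "x \<in> S" for x
    proof -
      have "card (S - {x}) < r" using S that by (metis card_Suc_Diff1 Suc_less_eq)
      then show ?thesis using D(2) S by (auto simp: even_below_def)
    qed
    have none: "card {B \<in> D. S - {x} \<subseteq> B} = 0" if "y \<in> S" "x \<noteq> y" "y \<in> {p, q}" for x y
    proof -
      have "{B \<in> D. S - {x} \<subseteq> B} = {}" using that pq by auto
      then show ?thesis by (simp only: card.empty)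
    qed
    \<comment> \<open>If \<open>S\<close> meets the pair, each summand is even: removing a point of
      \<open>S\<close> brings the size below \<open>r\<close>, and a point of the pair left in the
      set makes the count zero. If \<open>S\<close> misses the pair, the summands are equal, so
      their sum is even even when \<open>card S = r\<close>.\<close>
    consider "p \<in> S" "q \<in> S" | "p \<in> S" "q \<notin> S" | "p \<notin> S" "q \<in> S" | "p \<notin> S" "q \<notin> S" by blast
    then show "even (card {B \<in> ?E p \<union> ?E q. S \<subseteq> B})"
    proof cases
      case 1 then show ?thesis unfolding c using ev by simp
    next
      case 2 then show ?thesis using c ev[of p] none[of p q] n by (simp del: card_0_eq)
    next
      case 3 then show ?thesis using c ev[of q] none[of q p] n by (simp del: card_0_eq)
    next
      case 4 then show ?thesis unfolding c by simp
    qed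
  qed
  moreover have "card (?E p \<union> ?E q) = 2 ^ Suc r"
    using fD disj inj D(3) by (simp add: card_Un_disjoint card_image)
  moreover have "?E p \<union> ?E q \<subseteq> nsets {..<n} k"
  proof -
    have "insert x B \<in> nsets {..<n} k" if "x \<in> {p, q}" "B \<in> D" for x B
      using that pq[OF that(2)] n k by (auto simp: nsets_def)
    then show ?thesis by blast
  qed
  ultimately show ?case by blast
qed

lemma min_blocks_eq:
  assumes "binary_design t {..<n} k D"
    and "\<And>E. binary_design t {..<n} k E \<Longrightarrow> card D \<le> card E"
  shows "min_blocks t n k = enat (card D)"
  unfolding min_blocks_def
  by (rule antisym) (use assms in \<open>auto intro!: INF_lower INF_greatest\<close>)

theorem theorem3:
  fixes t k :: nat
  assumes "t \<ge> 1" and "k > 0"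
    and "[k = t] (mod 2 ^ (nat \<lfloor>log 2 (real t)\<rfloor> + 1))"
  shows "(\<forall>n>k. \<forall>N :: 'a set. finite N \<and> card N = n \<longrightarrow>
            (\<forall>D. binary_design t N k D \<longrightarrow> (\<forall>s\<le>t. binary_design s N k D))) \<and>
         (\<forall>n\<ge>k + t + 1.
            (\<forall>N :: 'a set. finite N \<and> card N = n \<longrightarrow>
               (\<forall>D. binary_design t N k D \<longrightarrow> card D \<ge> 2 ^ (t + 1))) \<and>
            (k \<noteq> t \<longrightarrow> min_blocks t n k = 2 ^ (t + 1)))"
proof -
  \<comment> \<open>\<open>e\<close> is the number of binary digits of \<open>t\<close>, so
    \<open>t\<close> is its own residue modulo \<open>2 ^ e\<close>.\<close>
  define e where "e = nat \<lfloor>log 2 (real t)\<rfloor> + 1"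
  have "log 2 (real t) < real e"
    unfolding e_def by linarith
  then have "real t < 2 ^ e"
    using assms(1) by (simp add: log_less_iff powr_realpow)
  then have te: "t < 2 ^ e"
    by (metis of_nat_less_iff of_nat_numeral of_nat_power)
  have "k mod 2 ^ e = t"
    using assms(3) te unfolding cong_def e_def by simp
  then obtain m where k: "k = t + m * 2 ^ e"
    by (metis mod_mult_div_eq mult.commute)
  have odd: "odd ((k - s) choose (t - s))" if "s \<le> t" for s
  proof -
    \<comment> \<open>Lowering both numbers by \<open>s\<close> keeps the same multiple of
      \<open>2 ^ e\<close>, so one congruence serves all \<open>s\<close>.\<close>
    have "k - s = (t - s) + m * 2 ^ e" using that k by simp
    then show ?thesis using te by (simp add: odd_choose_add_power_two_multiple)
  qed
  have lower: "binary_design s N k D"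
    if "finite N" "binary_design t N k D" "s \<le> t" for s D and N :: "'b set"
    using that(1,2,3) odd[OF that(3)] by (rule binary_design_lower)
  \<comment> \<open>The type \<open>'b\<close> is left general because the bound is used both for
    \<open>'a\<close> and for the natural numbers in \<open>min_blocks\<close>.\<close>
  have bound: "2 ^ (t + 1) \<le> card D"
    if N: "finite N" and D: "binary_design t N k D" for D and N :: "'b set"
  proof -
    have *: "D \<noteq> {}" "D \<subseteq> nsets N k" using D by (auto simp: binary_design_def)
    then have "even_below (t + 1) D"
      using lower[OF N D] by (simp add: even_below_iff_binary_design)
    then show ?thesis
      using * N by (intro even_below_card_ge) (auto intro: finite_subset finite_imp_finite_nsets)
  qed
  have "min_blocks t n k = 2 ^ (t + 1)" if "n \<ge> k + t + 1" "k \<noteq> t" for n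
  proof -
    \<comment> \<open>Here \<open>k \<noteq> t\<close> forces \<open>m > 0\<close>. For
      \<open>k = t\<close> there is no design, as a block would be the only one containing itself,
      and the minimum would be infinite.\<close>
    have "t + 1 \<le> k" using k that by (cases "m = 0") (simp_all add: Suc_le_eq)
    then obtain D where D: "D \<subseteq> nsets {..<n} k" "even_below (t + 1) D" "card D = 2 ^ (t + 1)"
      using exists_even_below[of "t + 1" k n] \<open>n \<ge> k + t + 1\<close> by auto
    then have "D \<noteq> {}" by auto
    with D have "binary_design t {..<n} k D"
      using even_below_iff_binary_design by (metis less_add_one)
    then have "min_blocks t n k = enat (card D)"
      using D(3) bound by (intro min_blocks_eq) auto
    then show ?thesis
      using D(3) by (metis numeral_eq_enat of_nat_eq_enat of_nat_numeral of_nat_power)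
  qed
  then show ?thesis using lower bound by auto
qed

end
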